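(* Let $(L,\mathcal G)$ be a nestoid. The universe fan $\mathcal U_{\mathcal G}$ is a subfan of the minimal lightcone refinement of $\Sigma^{2\mathcal G}$.
   Context: All lattices are finite. Let $L$ be a lattice with minimum $\hat 0$ and maximum $\hat 1$. A subset $\mathcal G\subseteq L_{>\hat 0}$ is nestable if $\hat 1\in\mathcal G$ and for any two incomparable $f,g\in\mathcal G$, $f\vee g\notin\mathcal G$ implies $f\wedge g=\hat 0$. A subset $N\subseteq\mathcal G$ is nested if for all $k\ge 2$ and pairwise incomparable $f_1,\dots,f_k\in N$ one has $f_1\vee\dots\vee f_k\notin\mathcal G$. $\mathcal N(L,\mathcal G)$ is the simplicial complex of nested sets. $(L,\mathcal G)$ is a nestoid if $\mathcal G$ is nestable and for every $f\in\mathcal G$ the complex $\mathcal N([\hat 0,f],\mathcal G\cap[\hat 0,f])$ is pure. $\mathbb R^{2\mathcal G}$ is the real vector space with basis $f^+,f^-$ ($f\in\mathcal G$); $p_f,m_f$ are the dual coordinates. For a nested set $N$, $\mathbb R^{2N}$ is the span of $f^\pm$, $f\in N$, and $\mathbb R_+^{2N}$ the cone they span. The fan $\Sigma^{2\mathcal G}$ consists of all faces of the cones $\mathbb R_+^{2N}$, $N\in\mathcal N(L,\mathcal G)$. For $g\in\mathcal G$ put $F_g:=p_{\hat 1}+\sum_{f\in\mathcal G,\ g<f<\hat 1}(p_f-m_f)-m_g$. The causal cone is $\{m_{\hat 1}=0,\ p_g\ge0,\ m_g\ge0,\ F_g\ge 0\ \forall g\in\mathcal G\}$. The universe fan $\mathcal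 U_{\mathcal G}$ is obtained by intersecting the cones of $\Sigma^{2\mathcal G}$ with the causal cone (its cones are these intersections and all their faces). Lightcone subdivisions: let $N$ be a nested set and $\mathcal B_N$ a Boolean building set on $N$ (a collection of nonempty subsets of $N$ containing all singletons and closed under unions of intersecting members). Let $u_{\mathrm{tot}}=\sum_{g\in N}g\in\mathbb R^N$ and let $\phi:\mathbb R^{2N}\to\mathbb R^N/\langle u_{\mathrm{tot}}\rangle$ be the linear map $\phi(f^+)=\sum_{g\in N,\,g<f}g$, $\phi(f^-)=\sum_{g\in N,\ g>f\text{ or }g\wedge f=\hat 0}g$. The domains of linearity of $x\mapsto\sum_{t\in\mathcal B_N}\min_{g\in t}x_g$ define a complete fan in $\mathbb R^N/\langle u_{\mathrm{tot}}\rangle$; the lightcone subdivision of $\mathbb R_+^{2N}$ associated to $\mathcal B_N$ is the intersection with $\mathbb R_+^{2N}$ of the pullback of this fan under $\phi$. The minimal lightcone refinement of $\Sigma^{2\mathcal G}$ is the fan in $\mathbb R^{2\mathcal G}$ assembled from the lightcone subdivisions of all $\mathbb R^{2N}_+$, $N\in\mathcal N(L,\mathcal G)$, associated to the minimal building sets $\mathcal B_N=\{N\}\cup\{\{f\}\mid f\in N\}$. *)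

theory Defs
  imports "HOL-Analysis.Analysis"
begin

section \<open>Nested sets and nestoids\<close>

text \<open>A finite lattice is a type of class \<open>{finite, bounded_lattice}\<close>. A lower interval
  \<open>[bot, f]\<close> is a sublattice with the same meets and joins, so its nested sets are the nested
  sets of \<open>G \<inter> {bot..f}\<close> computed in the ambient lattice.\<close>

definition incomparable :: "'a::order \<Rightarrow> 'a \<Rightarrow> bool" where
  "incomparable f g \<longleftrightarrow> \<not> f \<le> g \<and> \<not> g \<le> f"

definition nestable :: "'a::{finite,bounded_lattice} set \<Rightarrow> bool" where
  "nestable G \<longleftrightarrow> G \<subseteq> {bot<..} \<and> top \<in> G \<and>
     (\<forall>f\<in>G. \<forall>g\<in>G. incomparable f g \<longrightarrow> sup f g \<notin> G \<longrightarrow> inf f g = bot)"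

definition nested :: "'a::{finite,bounded_lattice} set \<Rightarrow> 'a set \<Rightarrow> bool" where
  "nested G N \<longleftrightarrow> N \<subseteq> G \<and>
     (\<forall>S\<subseteq>N. card S \<ge> 2 \<longrightarrow> pairwise incomparable S \<longrightarrow> Sup_fin S \<notin> G)"

definition nested_complex :: "'a::{finite,bounded_lattice} set \<Rightarrow> 'a set set" where
  "nested_complex G = {N. nested G N}"

definition pure_complex :: "'v set set \<Rightarrow> bool" where
  "pure_complex K \<longleftrightarrow>
     (\<forall>S\<in>K. \<forall>T\<in>K. (\<forall>U\<in>K. S \<subseteq> U \<longrightarrow> U = S) \<longrightarrow> (\<forall>U\<in>K. T \<subseteq> U \<longrightarrow> U = T) \<longrightarrow> card S = card T)"

definition nestoid :: "'a::{finite,bounded_lattice} set \<Rightarrow> bool" where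
  "nestoid G \<longleftrightarrow> nestable G \<and> (\<forall>f\<in>G. pure_complex (nested_complex (G \<inter> {bot..f})))"

section \<open>Fans\<close>

text \<open>For polyhedra the library's \<open>face_of\<close> gives the usual faces and, in addition, the empty
  set, which has to be excluded.\<close>

definition faces :: "'b::real_vector set \<Rightarrow> 'b set set" where
  "faces C = {F. F face_of C \<and> F \<noteq> {}}"

definition fan :: "'b::euclidean_space set set \<Rightarrow> bool" where
  "fan \<Sigma> \<longleftrightarrow> finite \<Sigma> \<and>
     (\<forall>C\<in>\<Sigma>. convex_cone C \<and> polyhedron C \<and> C \<inter> uminus ` C = {0}) \<and>
     (\<forall>C\<in>\<Sigma>. faces C \<subseteq> \<Sigma>) \<and>
     (\<forall>C\<in>\<Sigma>. \<forall>D\<in>\<Sigma>. C \<inter> D \<in> faces C \<and> C \<inter> D \<in> faces D)"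

definition subfan :: "'b::euclidean_space set set \<Rightarrow> 'b set set \<Rightarrow> bool" where
  "subfan \<Sigma> \<Delta> \<longleftrightarrow> fan \<Sigma> \<and> fan \<Delta> \<and> \<Sigma> \<subseteq> \<Delta>"

section \<open>The universe fan\<close>

text \<open>The spaces spanned by \<open>f\<^sup>+, f\<^sup>-\<close> for \<open>f\<close> in \<open>G\<close> or \<open>N\<close> are coordinate
  subspaces of \<open>'a signed_vec\<close>; the coordinates \<open>p\<^sub>f\<close> and \<open>m\<^sub>f\<close> of
  \<open>x\<close> are \<open>fst x $ f\<close> and \<open>snd x $ f\<close>.\<close>

type_synonym 'a signed_vec = "(real, 'a) vec \<times> (real, 'a) vec"

definition pos :: "'a::finite \<Rightarrow> 'a signed_vec" where
  "pos f = (axis f 1, 0)"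

definition neg :: "'a::finite \<Rightarrow> 'a signed_vec" where
  "neg f = (0, axis f 1)"

abbreviation pcoord :: "'a signed_vec \<Rightarrow> 'a::finite \<Rightarrow> real" where
  "pcoord x f \<equiv> fst x $ f"

abbreviation mcoord :: "'a signed_vec \<Rightarrow> 'a::finite \<Rightarrow> real" where
  "mcoord x f \<equiv> snd x $ f"

definition space2 :: "'a::finite set \<Rightarrow> 'a signed_vec set" where
  "space2 S = span (pos ` S \<union> neg ` S)"

definition orthant2 :: "'a::finite set \<Rightarrow> 'a signed_vec set" where
  "orthant2 N = convex_cone hull (pos ` N \<union> neg ` N)"

definition Sigma2 :: "'a::{finite,bounded_lattice} set \<Rightarrow> 'a signed_vec set set" where
  "Sigma2 G = (\<Union>N\<in>nested_complex G. faces (orthant2 N))"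

definition causal_form ::
  "'a::{finite,bounded_lattice} set \<Rightarrow> 'a \<Rightarrow> 'a signed_vec \<Rightarrow> real" where
  "causal_form G g x =
     pcoord x top + (\<Sum>f\<in>{f\<in>G. g < f \<and> f < top}. pcoord x f - mcoord x f) - mcoord x g"

definition causal_cone :: "'a::{finite,bounded_lattice} set \<Rightarrow> 'a signed_vec set" where
  "causal_cone G = {x \<in> space2 G. mcoord x top = 0 \<and>
     (\<forall>g\<in>G. pcoord x g \<ge> 0 \<and> mcoord x g \<ge> 0 \<and> causal_form G g x \<ge> 0)}"

definition universe_fan ::
  "'a::{finite,bounded_lattice} set \<Rightarrow> 'a signed_vec set set" where
  "universe_fan G = (\<Union>\<sigma>\<in>Sigma2 G. faces (\<sigma> \<inter> causal_cone G))"

section \<open>Lightcone subdivisions\<close>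

definition boolean_building_set :: "'v set \<Rightarrow> 'v set set \<Rightarrow> bool" where
  "boolean_building_set N B \<longleftrightarrow>
     (\<forall>t\<in>B. t \<subseteq> N \<and> t \<noteq> {}) \<and> (\<forall>f\<in>N. {f} \<in> B) \<and>
     (\<forall>s\<in>B. \<forall>t\<in>B. s \<inter> t \<noteq> {} \<longrightarrow> s \<union> t \<in> B)"

text \<open>The nonemptiness condition only matters for \<open>N = {}\<close>.\<close>

definition minimal_building_set :: "'v set \<Rightarrow> 'v set set" where
  "minimal_building_set N = {t. t \<noteq> {} \<and> (t = N \<or> (\<exists>f\<in>N. t = {f}))}"

lemma boolean_building_set_minimal: "boolean_building_set N (minimal_building_set N)"
  unfolding boolean_building_set_def minimal_building_set_def by auto

definition space1 :: "'a::finite set \<Rightarrow> (real, 'a) vec set" where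
  "space1 N = span ((\<lambda>g. axis g 1) ` N)"

definition u_tot :: "'a::finite set \<Rightarrow> (real, 'a) vec" where
  "u_tot N = (\<Sum>g\<in>N. axis g 1)"

text \<open>Elements of the quotient of \<open>space1 N\<close> by the line through \<open>u_tot N\<close> are cosets.\<close>

definition quot :: "'a::finite set \<Rightarrow> (real, 'a) vec \<Rightarrow> (real, 'a) vec set" where
  "quot N y = (+) y ` span {u_tot N}"

definition light_map ::
  "'a::{finite,bounded_lattice} set \<Rightarrow> 'a signed_vec \<Rightarrow> (real, 'a) vec set" where
  "light_map N x = quot N (\<Sum>f\<in>N.
     pcoord x f *\<^sub>R (\<Sum>g\<in>{g\<in>N. g < f}. axis g 1) +
     mcoord x f *\<^sub>R (\<Sum>g\<in>{g\<in>N. g > f \<or> inf g f = bot}. axis g 1))"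

text \<open>The domains of linearity of \<open>h\<close> are the maximal convex subsets of \<open>V\<close> on which \<open>h\<close>
  agrees with a linear function. Convexity is needed: even for concave \<open>h\<close>, the locus where
  \<open>h\<close> agrees with an arbitrary linear function need not be convex.\<close>

definition linear_piece :: "'b::real_vector set \<Rightarrow> ('b \<Rightarrow> real) \<Rightarrow> 'b set \<Rightarrow> bool" where
  "linear_piece V h D \<longleftrightarrow> D \<subseteq> V \<and> convex D \<and> (\<exists>l. linear l \<and> (\<forall>x\<in>D. h x = l x))"

definition linearity_domains :: "'b::real_vector set \<Rightarrow> ('b \<Rightarrow> real) \<Rightarrow> 'b set set" where
  "linearity_domains V h =
     {D. linear_piece V h D \<and> (\<forall>E. linear_piece V h E \<longrightarrow> D \<subseteq> E \<longrightarrow> E = D)}"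

definition building_function :: "'a::finite set set \<Rightarrow> (real, 'a) vec \<Rightarrow> real" where
  "building_function B x = (\<Sum>t\<in>B. Min ((\<lambda>g. x $ g) ` t))"

text \<open>Translation by a multiple of \<open>u_tot N\<close> changes \<open>building_function B\<close> by a linear
  function, so its domains of linearity on \<open>space1 N\<close>, and hence their faces, are unions of
  cosets; faces in the quotient are the images of faces upstairs.\<close>

definition building_fan :: "'a::finite set \<Rightarrow> 'a set set \<Rightarrow> (real, 'a) vec set set set" where
  "building_fan N B =
     (\<Union>D\<in>linearity_domains (space1 N) (building_function B). (\<lambda>F. quot N ` F) ` faces D)"

definition lightcone_subdivision ::
  "'a::{finite,bounded_lattice} set \<Rightarrow> 'a set set \<Rightarrow> 'a signed_vec set set" where
  "lightcone_subdivision N B =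
     (\<Union>Q\<in>building_fan N B. faces {x \<in> orthant2 N. light_map N x \<in> Q})"

definition minimal_lightcone_refinement ::
  "'a::{finite,bounded_lattice} set \<Rightarrow> 'a signed_vec set set" where
  "minimal_lightcone_refinement G =
     (\<Union>N\<in>nested_complex G. lightcone_subdivision N (minimal_building_set N))"

end

theory Submission
  imports Defs
begin

text \<open>The function that decides which cell of a lightcone subdivision a point lies in does not
  depend on the nested set. A nested set is a forest, so for \<open>x\<close> in the orthant of \<open>N\<close> and \<open>g \<in> N\<close>
  the coordinate \<open>g\<close> of \<open>\<phi>(x)\<close> is a linear form \<open>\<Phi>\<^sub>g(x)\<close> in which \<open>N\<close> does not occur: the sum of
  \<open>p\<^sub>f\<close> over all lattice elements \<open>f > g\<close> plus the sum of \<open>m\<^sub>f\<close> over all lattice elements \<open>f\<close> with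
  \<open>\<not> g \<le> f\<close> (lemma \<open>light_vec_nth\<close>). For the minimal building set the subdivision of the orthant of
  \<open>N\<close> has one generating cell for each \<open>g \<in> N\<close>, on which \<open>\<Phi>\<^sub>g\<close> is the smallest of the \<open>\<Phi>\<^sub>h\<close>,
  \<open>h \<in> N\<close>. The point of the proof is lemma \<open>light_coord_min_attained\<close>: on this orthant the minimum
  of \<open>\<Phi>\<^sub>h\<close> over \<^emph>\<open>all\<close> \<open>h \<noteq> bot\<close> is already attained in \<open>N\<close>, if \<open>N\<close> is not empty. This has two
  consequences.

  \<^item> The cell of \<open>g\<close> in the orthant of \<open>N\<close> is cut out by the inequalities \<open>\<Phi>\<^sub>g \<le> \<Phi>\<^sub>h\<close>, \<open>h \<noteq> bot\<close>,
    in which \<open>N\<close> no longer occurs. Two cells therefore meet in the locus where the coordinates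
    outside one of the nested sets vanish and \<open>\<Phi>\<^sub>g = \<Phi>\<^sub>h\<close>, which is a face of both. So the
    refinement is a fan.

  \<^item> On the causal cone \<open>m\<close> vanishes at \<open>top\<close>, and where it does one has \<open>F\<^sub>g = \<Phi>\<^sub>g - \<Phi>\<^sub>t\<close> for
    \<open>t = top\<close> and \<open>g \<noteq> top\<close>. Hence the causal cone cuts an orthant whose nested set contains
    \<open>top\<close> in a face of the cell of \<open>top\<close>. Since \<open>top\<close> can be added to any nested set, every cone of
    the universe fan is a face of such a cell.

  A subset of a fan that is closed under faces is a fan, and this finishes the proof.\<close>

section \<open>Faces of cones\<close>

lemma faces_trans: "F \<in> faces C \<Longrightarrow> C face_of D \<Longrightarrow> F \<in> faces D"
  unfolding faces_def using face_of_trans by auto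

lemma face_of_linear_zero:
  assumes "convex S" "linear l" "\<And>x. x \<in> S \<Longrightarrow> 0 \<le> (l x :: real)"
  shows "{x \<in> S. l x = 0} face_of S"
  unfolding face_of_def
proof (intro conjI ballI impI)
  have "convex (l -` {0})"
    using convex_linear_vimage[OF assms(2) convex_singleton] .
  then show "convex {x \<in> S. l x = 0}"
    using convex_Int[OF assms(1), of "l -` {0}"] by (simp add: Int_def)
next
  fix a b x
  assume a: "a \<in> S" and b: "b \<in> S" and x: "x \<in> {x \<in> S. l x = 0}" "x \<in> open_segment a b"
  obtain u where u: "0 < u" "u < 1" "x = (1 - u) *\<^sub>R a + u *\<^sub>R b"
    using x(2) in_segment(2) by blast
  have "(1 - u) * l a + u * l b = 0"
    using x(1) u(3) by (simp add: linear_add[OF assms(2)] linear_cmul[OF assms(2)])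
  moreover have "(1 - u) * l a \<ge> 0" "u * l b \<ge> 0"
    using u assms(3)[OF a] assms(3)[OF b] by auto
  ultimately have "(1 - u) * l a = 0" "u * l b = 0" by linarith+
  then show "a \<in> {x \<in> S. l x = 0}" "b \<in> {x \<in> S. l x = 0}"
    using u a b by auto
qed auto

lemma face_of_linear_vimage:
  assumes "linear f" "convex S" "F face_of D"
  shows "{x \<in> S. f x \<in> F} face_of {x \<in> S. f x \<in> D}"
  unfolding face_of_def
proof (intro conjI ballI impI)
  show "{x \<in> S. f x \<in> F} \<subseteq> {x \<in> S. f x \<in> D}"
    using face_of_imp_subset[OF assms(3)] by auto
  have "convex (f -` F)"
    using convex_linear_vimage[OF assms(1) face_of_imp_convex[OF assms(3)]] .
  then show "convex {x \<in> S. f x \<in> F}"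
    using convex_Int[OF assms(2), of "f -` F"] by (simp add: Int_def)
next
  fix a b x
  assume a: "a \<in> {x \<in> S. f x \<in> D}" and b: "b \<in> {x \<in> S. f x \<in> D}"
    and x: "x \<in> {x \<in> S. f x \<in> F}" "x \<in> open_segment a b"
  obtain u where u: "0 < u" "u < 1" "x = (1 - u) *\<^sub>R a + u *\<^sub>R b"
    using x(2) in_segment(2) by blast
  have fx: "f x = (1 - u) *\<^sub>R f a + u *\<^sub>R f b"
    using u(3) by (simp add: linear_add[OF assms(1)] linear_cmul[OF assms(1)])
  have "f a \<in> F \<and> f b \<in> F"
  proof (cases "f a = f b")
    \<comment> \<open>the image of the segment may shrink to a point, which has no open segment\<close>
    case True
    then have "f x = f a" using fx by (simp flip: scaleR_left_distrib)
    then show ?thesis using True x(1) by simp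
  next
    case False
    then have "f x \<in> open_segment (f a) (f b)"
      using fx u in_segment(2) by blast
    then show ?thesis
      using assms(3) a b x(1) unfolding face_of_def by blast
  qed
  then show "a \<in> {x \<in> S. f x \<in> F}" "b \<in> {x \<in> S. f x \<in> F}" using a b by auto
qed

text \<open>A face that contains \<open>x\<close> contains the whole ray through \<open>x\<close>, because \<open>x\<close> is an inner point of
  that ray unless \<open>x = 0\<close>.\<close>

lemma convex_cone_face:
  assumes C: "convex_cone C" and F: "F \<in> faces C"
  shows "convex_cone F"
proof -
  have Fo: "F face_of C" and ne: "F \<noteq> {}" using F unfolding faces_def by auto
  have sc: "c *\<^sub>R x \<in> F" if x: "x \<in> F" and c: "0 \<le> c" for x c
  proof (cases "x = 0 \<or> c = 1")
    case True
    then show ?thesis using x by auto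
  next
    case False
    have xC: "x \<in> C" using Fo x face_of_imp_subset by blast
    \<comment> \<open>\<open>x\<close> lies strictly between two other points of its ray, one of which is \<open>c x\<close>\<close>
    let ?d = "if c < 1 then 2 else 0 :: real"
    have "x \<in> open_segment (c *\<^sub>R x) (?d *\<^sub>R x)"
    proof -
      define u where "u = (if c < 1 then (1 - c) / (2 - c) else 1 - 1 / c)"
      have u: "0 < u" "u < 1" using False c by (auto simp: u_def field_simps)
      have "(1 - u) * c + u * ?d = 1" using False c by (auto simp: u_def field_simps)
      then have "x = (1 - u) *\<^sub>R (c *\<^sub>R x) + u *\<^sub>R (?d *\<^sub>R x)"
        by (metis scaleR_left_distrib scaleR_one scaleR_scaleR)
      moreover have "c *\<^sub>R x \<noteq> ?d *\<^sub>R x" using False c by auto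
      ultimately show ?thesis using u in_segment(2) by blast
    qed
    moreover have "c *\<^sub>R x \<in> C" "?d *\<^sub>R x \<in> C"
      using convex_cone_scaleR[OF C _ xC] c by auto
    ultimately show ?thesis using Fo x unfolding face_of_def by blast
  qed
  show ?thesis
    unfolding convex_cone_def conic_def using ne sc face_of_imp_convex[OF Fo] by auto
qed

lemma polyhedron_linear_inequalities:
  fixes \<Lambda> :: "('b::euclidean_space \<Rightarrow> real) set"
  assumes "finite \<Lambda>" "\<And>l. l \<in> \<Lambda> \<Longrightarrow> linear l"
  shows "polyhedron {x. \<forall>l\<in>\<Lambda>. 0 \<le> l x}"
proof -
  have "polyhedron {x. 0 \<le> l x}" if "l \<in> \<Lambda>" for l
  proof -
    have "l x = adjoint l 1 \<bullet> x" for x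
      using adjoint_works[OF assms(2)[OF that], of x 1] by (simp add: inner_commute)
    then show ?thesis using polyhedron_halfspace_ge[of 0 "adjoint l 1"] by simp
  qed
  then have "polyhedron (\<Inter>l\<in>\<Lambda>. {x. 0 \<le> l x})" using assms(1) by auto
  moreover have "(\<Inter>l\<in>\<Lambda>. {x. 0 \<le> l x}) = {x. \<forall>l\<in>\<Lambda>. 0 \<le> l x}" by auto
  ultimately show ?thesis by simp
qed

lemma convex_cone_linear_inequalities:
  fixes \<Lambda> :: "('b::real_vector \<Rightarrow> real) set"
  assumes "\<And>l. l \<in> \<Lambda> \<Longrightarrow> linear l"
  shows "convex_cone {x. \<forall>l\<in>\<Lambda>. 0 \<le> l x}"
  unfolding convex_cone_iff using assms
  by (auto simp: linear_0 linear_add linear_cmul)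

section \<open>Generating fans\<close>

text \<open>Two faces \<open>E\<close> and \<open>F\<close> of cells \<open>C\<close> and \<open>D\<close> meet inside \<open>C \<inter> D\<close>, which is a face of both
  cells; there they are cut down to two faces of the one cone \<open>C \<inter> D\<close>, and the intersection of
  these is a face.\<close>

lemma fan_generated_by_cells:
  fixes S :: "'b::euclidean_space set set"
  assumes "finite S"
    and cone: "\<And>C. C \<in> S \<Longrightarrow> convex_cone C"
    and poly: "\<And>C. C \<in> S \<Longrightarrow> polyhedron C"
    and pointed: "\<And>C x. C \<in> S \<Longrightarrow> x \<in> C \<Longrightarrow> - x \<in> C \<Longrightarrow> x = 0"
    and meet: "\<And>C D. C \<in> S \<Longrightarrow> D \<in> S \<Longrightarrow> C \<inter> D face_of C"
  shows "fan (\<Union>C\<in>S. faces C)"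
  unfolding fan_def
proof (intro conjI ballI)
  have "finite (faces C)" if "C \<in> S" for C
    using finite_polyhedron_faces[OF poly[OF that]] unfolding faces_def
    by (rule rev_finite_subset) auto
  then show "finite (\<Union>C\<in>S. faces C)" using assms(1) by auto
next
  fix F assume "F \<in> (\<Union>C\<in>S. faces C)"
  then obtain C where C: "C \<in> S" and F: "F \<in> faces C" by auto
  have Fo: "F face_of C" using F faces_def by auto
  show cF: "convex_cone F" using convex_cone_face[OF cone[OF C] F] .
  show "polyhedron F" using face_of_polyhedron_polyhedron[OF poly[OF C] Fo] .
  have "F \<subseteq> C" using Fo by (rule face_of_imp_subset)
  then have "x \<in> C" "- x \<in> C" if "x \<in> F \<inter> uminus ` F" for x
    using that by auto
  then have "x = 0" if "x \<in> F \<inter> uminus ` F" for x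
    using that pointed[OF C] by blast
  then show "F \<inter> uminus ` F = {0}"
    using convex_cone_contains_0[OF cF] by (auto intro: image_eqI[of _ _ 0])
  show "faces F \<subseteq> (\<Union>C\<in>S. faces C)"
    using C Fo faces_trans by blast
next
  fix E F assume "E \<in> (\<Union>C\<in>S. faces C)" "F \<in> (\<Union>C\<in>S. faces C)"
  moreover have "E \<inter> F \<in> faces E"
    if C: "C \<in> S" and D: "D \<in> S" and E: "E \<in> faces C" and F: "F \<in> faces D" for C D E F
  proof -
    have Eo: "E face_of C" and Fo: "F face_of D" using E F faces_def by auto
    have CD: "C \<inter> D face_of C" "C \<inter> D face_of D"
      using meet[OF C D] meet[OF D C] by (auto simp: Int_commute)
    have "E \<inter> (C \<inter> D) face_of C \<inter> D"
      using face_of_subset[OF face_of_Int[OF Eo CD(1)]] by auto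
    moreover have "F \<inter> (C \<inter> D) face_of C \<inter> D"
      using face_of_subset[OF face_of_Int[OF Fo CD(2)]] by auto
    ultimately have "(E \<inter> (C \<inter> D)) \<inter> (F \<inter> (C \<inter> D)) face_of C \<inter> D"
      by (rule face_of_Int)
    moreover have "(E \<inter> (C \<inter> D)) \<inter> (F \<inter> (C \<inter> D)) = E \<inter> F"
      using face_of_imp_subset[OF Eo] face_of_imp_subset[OF Fo] by auto
    ultimately have "E \<inter> F face_of C" using CD(1) face_of_trans by metis
    then have "E \<inter> F face_of E"
      by (rule face_of_subset) (use face_of_imp_subset[OF Eo] in auto)
    moreover have "0 \<in> E \<inter> F"
      using convex_cone_contains_0 convex_cone_face cone C D E F by blast
    ultimately show ?thesis unfolding faces_def by auto
  qed
  ultimately show "E \<inter> F \<in> faces E" "E \<inter> F \<in> faces F"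
    by (blast, (subst Int_commute, blast))
qed

lemma subfan_closed_under_faces:
  assumes \<Delta>: "fan \<Delta>" and sub: "\<Sigma> \<subseteq> \<Delta>" and closed: "\<And>C. C \<in> \<Sigma> \<Longrightarrow> faces C \<subseteq> \<Sigma>"
  shows "subfan \<Sigma> \<Delta>"
proof -
  have "finite \<Sigma>" using \<Delta> sub finite_subset unfolding fan_def by blast
  then show ?thesis
    using \<Delta> sub closed unfolding subfan_def fan_def by (auto simp: subset_iff)
qed

section \<open>Coordinates on the orthants\<close>

lemma axis_nth_eq: "axis g (1::real) $ h = (if g = h then 1 else 0)"
  by (simp add: axis_def)

lemma orthant2_eq:
  "orthant2 N = {x. \<forall>f. 0 \<le> pcoord x f \<and> 0 \<le> mcoord x f \<and>
     (f \<notin> N \<longrightarrow> pcoord x f = 0 \<and> mcoord x f = 0)}" (is "_ = ?R")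
proof
  have "convex_cone ?R"
    unfolding convex_cone_iff by (auto intro!: add_nonneg_nonneg mult_nonneg_nonneg)
  moreover have "pos ` N \<union> neg ` N \<subseteq> ?R"
    by (auto simp: pos_def neg_def axis_nth_eq)
  ultimately show "orthant2 N \<subseteq> ?R"
    unfolding orthant2_def by (rule hull_minimal[rotated])
next
  show "?R \<subseteq> orthant2 N"
  proof
    fix x assume x: "x \<in> ?R"
    let ?C = "orthant2 N"
    have C: "convex_cone ?C" unfolding orthant2_def by (rule convex_cone_convex_cone_hull)
    have in_C: "pos f \<in> ?C" "neg f \<in> ?C" if "f \<in> N" for f
      using that unfolding orthant2_def by (auto intro: hull_inc)
    have sum_in: "(\<Sum>f\<in>M. pcoord x f *\<^sub>R pos f + mcoord x f *\<^sub>R neg f) \<in> ?C"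
      if "M \<subseteq> N" for M
      using finite[of M] that
    proof induction
      case empty
      then show ?case using convex_cone_contains_0[OF C] by simp
    next
      case (insert f M)
      have "pcoord x f *\<^sub>R pos f + mcoord x f *\<^sub>R neg f \<in> ?C"
        using x insert.prems in_C[of f]
        by (intro convex_cone_add[OF C] convex_cone_scaleR[OF C]) auto
      then show ?case using insert convex_cone_add[OF C] by simp
    qed
    have "x = (\<Sum>f\<in>N. pcoord x f *\<^sub>R pos f + mcoord x f *\<^sub>R neg f)"
    proof (rule prod_eqI)
      show "fst x = fst (\<Sum>f\<in>N. pcoord x f *\<^sub>R pos f + mcoord x f *\<^sub>R neg f)"
        using x by (simp add: vec_eq_iff fst_sum pos_def neg_def axis_nth_eq
            if_distrib[of "\<lambda>a. _ * a"] sum.delta cong: if_cong)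
      show "snd x = snd (\<Sum>f\<in>N. pcoord x f *\<^sub>R pos f + mcoord x f *\<^sub>R neg f)"
        using x by (simp add: vec_eq_iff snd_sum pos_def neg_def axis_nth_eq
            if_distrib[of "\<lambda>a. _ * a"] sum.delta cong: if_cong)
    qed
    then show "x \<in> ?C" using sum_in[OF order_refl] by (rule ssubst)
  qed
qed

lemma convex_orthant2: "convex (orthant2 N)"
  unfolding orthant2_def by (rule convex_convex_cone_hull)

lemma linear_pcoord: "linear (\<lambda>x. pcoord x f)" and linear_mcoord: "linear (\<lambda>x. mcoord x f)"
  by (auto intro: linearI)

lemma orthant2_face:
  assumes "M \<subseteq> N"
  shows "orthant2 M face_of orthant2 N"
proof -
  let ?l = "\<lambda>x. \<Sum>f\<in>- M. pcoord x f + mcoord x f"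
  have l: "linear ?l"
    by (intro linear_compose_sum ballI linear_compose_add linear_pcoord linear_mcoord)
  have "{x \<in> orthant2 N. ?l x = 0} face_of orthant2 N"
    by (rule face_of_linear_zero[OF convex_orthant2 l])
       (auto simp: orthant2_eq intro!: sum_nonneg add_nonneg_nonneg)
  moreover have "?l x = 0 \<longleftrightarrow> (\<forall>f\<in>- M. pcoord x f = 0 \<and> mcoord x f = 0)"
    if "x \<in> orthant2 N" for x
    using that by (subst sum_nonneg_eq_0_iff)
      (auto simp: orthant2_eq add_nonneg_eq_0_iff intro!: add_nonneg_nonneg)
  then have "{x \<in> orthant2 N. ?l x = 0} = orthant2 M"
    using assms unfolding orthant2_eq by blast
  ultimately show ?thesis by simp
qed

lemma space1_eq: "space1 N = {y. \<forall>g. g \<notin> N \<longrightarrow> y $ g = 0}" (is "_ = ?R")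
proof
  have "subspace ?R" by (auto simp: subspace_def)
  then show "space1 N \<subseteq> ?R"
    unfolding space1_def by (intro span_minimal) (auto simp: axis_nth_eq)
next
  show "?R \<subseteq> space1 N"
  proof
    fix y :: "(real, 'a) vec" assume y: "y \<in> ?R"
    have "y = (\<Sum>g\<in>N. (y $ g) *\<^sub>R axis g 1)"
      using y by (simp add: vec_eq_iff axis_nth_eq if_distrib[of "\<lambda>a. _ * a"] sum.delta
          cong: if_cong)
    also have "\<dots> \<in> space1 N"
      unfolding space1_def by (intro span_sum span_scale span_base) auto
    finally show "y \<in> space1 N" .
  qed
qed

section \<open>Nested sets are forests\<close>

lemma nested_forest:
  assumes G: "nestable G" and N: "nested G N" and f: "f \<in> N" and g: "g \<in> N"
  shows "f \<le> g \<or> g \<le> f \<or> inf f g = bot"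
proof (rule ccontr)
  assume neg: "\<not> ?thesis"
  then have inc: "incomparable f g" and ne: "f \<noteq> g" by (auto simp: incomparable_def)
  have "Sup_fin {f, g} \<notin> G"
    using N f g ne inc unfolding nested_def
    by (auto simp: pairwise_def incomparable_def dest!: spec[of _ "{f, g}"])
  then have "sup f g \<notin> G" by simp
  moreover have "f \<in> G" "g \<in> G" using N f g unfolding nested_def by auto
  ultimately have "inf f g = bot" using G inc unfolding nestable_def by blast
  then show False using neg by simp
qed

text \<open>The elements of a nested set above a given \<open>h \<noteq> bot\<close> form a chain, for every \<open>h\<close> in
  the lattice: two incomparable ones would have meet \<open>bot\<close>.\<close>

lemma nested_common_lower_bound:
  assumes "nestable G" "nested G N" "f \<in> N" "g \<in> N" "h \<noteq> bot" "h \<le> f" "h \<le> g"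
  shows "f \<le> g \<or> g \<le> f"
  using nested_forest[OF assms(1-4)] assms(5-7) by (metis le_inf_iff bot_unique)

lemma nested_insert_top:
  assumes "nestable G" "nested G N"
  shows "nested G (insert top N)"
proof -
  have "S \<subseteq> N" if "S \<subseteq> insert top N" "card S \<ge> 2" "pairwise incomparable S" for S
  proof -
    have "top \<notin> S"
    proof
      assume "top \<in> S"
      then have "x = top" if "x \<in> S" for x
        using \<open>pairwise incomparable S\<close> that top_greatest[of x]
        unfolding pairwise_def incomparable_def by blast
      then have "S = {top}" using \<open>top \<in> S\<close> by auto
      then show False using that(2) by simp
    qed
    then show ?thesis using that(1) by auto
  qed
  then show ?thesis using assms unfolding nested_def nestable_def by auto
qed

section \<open>Light coordinates\<close>

text \<open>This is \<open>\<Phi>\<^sub>g\<close>. Its sums run over the whole lattice; points of an orthant are supported on a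
  nested set, and incomparable elements of a nested set have meet \<open>bot\<close>, so there it agrees with the
  coordinate \<open>g\<close> of \<open>\<phi>\<close>.\<close>

definition light_coord :: "'a::{finite,bounded_lattice} \<Rightarrow> 'a signed_vec \<Rightarrow> real" where
  "light_coord g x = (\<Sum>f\<in>{f. g < f}. pcoord x f) + (\<Sum>f\<in>{f. \<not> g \<le> f}. mcoord x f)"

lemma linear_light_coord: "linear (light_coord g)"
  unfolding light_coord_def
  by (intro linear_compose_add linear_compose_sum ballI linear_pcoord linear_mcoord)

lemma sum_support:
  fixes c :: "'a::finite \<Rightarrow> real"
  assumes "\<And>f. f \<notin> N \<Longrightarrow> c f = 0"
  shows "sum c {f. P f} = sum c {f \<in> N. P f}"
  by (rule sum.mono_neutral_right) (use assms in auto)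

lemma light_coord_nested:
  assumes "x \<in> orthant2 N"
  shows "light_coord g x
    = (\<Sum>f\<in>{f \<in> N. g < f}. pcoord x f) + (\<Sum>f\<in>{f \<in> N. \<not> g \<le> f}. mcoord x f)"
  using assms unfolding light_coord_def orthant2_eq
  by (intro arg_cong2[where f="(+)"] sum_support) auto

text \<open>Let \<open>h \<notin> N\<close>. If \<open>h\<close> lies below some element of \<open>N\<close>, let \<open>r\<close> be the least element of \<open>N\<close> above it. Passing
  from \<open>h\<close> up to \<open>r\<close> only loses the summand \<open>p\<^sub>r\<close>. If \<open>h\<close> lies below no element of \<open>N\<close>, then \<open>\<Phi>\<^sub>h\<close> is
  the sum of all \<open>m\<^sub>f\<close>, and for a maximal element \<open>r\<close> of \<open>N\<close> the form \<open>\<Phi>\<^sub>r\<close> is the same sum without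
  \<open>m\<^sub>r\<close>. On the orthant both lost summands are nonnegative.\<close>

lemma light_coord_min_attained:
  assumes G: "nestable G" and N: "nested G N" and ne: "N \<noteq> {}" and h: "h \<noteq> bot"
    and x: "x \<in> orthant2 N"
  shows "\<exists>r\<in>N. light_coord r x \<le> light_coord h x"
proof -
  have nn: "0 \<le> pcoord x f" "0 \<le> mcoord x f" for f using x by (auto simp: orthant2_eq)
  consider "h \<in> N" | "h \<notin> N" "\<exists>f\<in>N. h \<le> f" | "\<forall>f\<in>N. \<not> h \<le> f" by blast
  then show ?thesis
  proof cases
    case 1
    then show ?thesis by auto
  next
    case 2
    obtain r where r: "r \<in> N" "h \<le> r" and min: "\<And>f. f \<in> N \<Longrightarrow> h \<le> f \<Longrightarrow> f \<le> r \<Longrightarrow> f = r"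
      using finite_has_minimal[of "{f \<in> N. h \<le> f}"] 2(2) by auto
    \<comment> \<open>the elements of \<open>N\<close> above \<open>h\<close> form a chain, so a minimal one is the least\<close>
    have least: "h \<le> f \<longleftrightarrow> r \<le> f" if "f \<in> N" for f
      using nested_common_lower_bound[OF G N that r(1) h _ r(2)] min[OF that] r(2)
        order_trans[of h r f] by auto
    have m: "{f \<in> N. \<not> h \<le> f} = {f \<in> N. \<not> r \<le> f}" using least by auto
    have p: "{f \<in> N. r < f} \<subseteq> {f \<in> N. h < f}" using r(2) by auto
    have "(\<Sum>f\<in>{f \<in> N. r < f}. pcoord x f) \<le> (\<Sum>f\<in>{f \<in> N. h < f}. pcoord x f)"
      by (rule sum_mono2) (use p nn in auto)
    then show ?thesis
      unfolding light_coord_nested[OF x] by (intro bexI[OF _ r(1)]) (simp add: m)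
  next
    case 3
    obtain r where r: "r \<in> N" and max: "\<And>f. f \<in> N \<Longrightarrow> r \<le> f \<Longrightarrow> f = r"
      using finite_has_maximal[OF finite ne] by auto
    have p: "{f \<in> N. r < f} = {}" "{f \<in> N. h < f} = {}"
      using max 3 by (auto simp: order_less_le)
    have "(\<Sum>f\<in>{f \<in> N. \<not> r \<le> f}. mcoord x f) \<le> (\<Sum>f\<in>{f \<in> N. \<not> h \<le> f}. mcoord x f)"
      by (rule sum_mono2) (use nn 3 in auto)
    then show ?thesis
      unfolding light_coord_nested[OF x] by (intro bexI[OF _ r]) (simp add: p)
  qed
qed

section \<open>Cells of the minimal lightcone refinement\<close>

text \<open>The comparison with all \<open>h \<noteq> bot\<close>, instead of only \<open>h \<in> N\<close>, makes cells of different orthants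
  directly comparable.\<close>

definition light_cell :: "'a::{finite,bounded_lattice} set \<Rightarrow> 'a \<Rightarrow> 'a signed_vec set" where
  "light_cell N g = {x \<in> orthant2 N. \<forall>h. h \<noteq> bot \<longrightarrow> light_coord g x \<le> light_coord h x}"

lemma light_cell_subset: "light_cell N g \<subseteq> orthant2 N"
  unfolding light_cell_def by auto

lemma light_cell_eq:
  assumes "nestable G" "nested G N" "g \<in> N"
  shows "light_cell N g = {x \<in> orthant2 N. \<forall>h\<in>N. light_coord g x \<le> light_coord h x}"
proof -
  have "bot \<notin> N" using assms(1,2) unfolding nestable_def nested_def by auto
  moreover have "light_coord g x \<le> light_coord h x"
    if x: "x \<in> orthant2 N" "\<forall>h\<in>N. light_coord g x \<le> light_coord h x" and h: "h \<noteq> bot" for x h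
  proof -
    obtain r where "r \<in> N" "light_coord r x \<le> light_coord h x"
      using light_coord_min_attained[OF assms(1,2) _ h x(1)] assms(3) by auto
    then show ?thesis using x(2) by force
  qed
  ultimately show ?thesis unfolding light_cell_def by (intro Collect_cong) metis
qed

lemma light_cell_inequalities:
  "\<exists>\<Lambda>. finite \<Lambda> \<and> (\<forall>l\<in>\<Lambda>. linear l) \<and> light_cell N g = {x. \<forall>l\<in>\<Lambda>. 0 \<le> (l x :: real)}"
proof -
  let ?\<Lambda> = "range (\<lambda>f x. pcoord x f) \<union> range (\<lambda>f x. mcoord x f)
    \<union> (\<lambda>f x. - pcoord x f) ` (- N) \<union> (\<lambda>f x. - mcoord x f) ` (- N)
    \<union> (\<lambda>h x. light_coord h x - light_coord g x) ` {h. h \<noteq> bot}"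
  have "finite ?\<Lambda>" by simp
  moreover have "\<forall>l\<in>?\<Lambda>. linear l"
    by (auto intro: linear_pcoord linear_mcoord linear_compose_neg linear_compose_sub
        linear_light_coord)
  moreover have "light_cell N g = {x. \<forall>l\<in>?\<Lambda>. 0 \<le> l x}"
  proof (intro set_eqI)
    fix x
    have "(\<forall>l\<in>?\<Lambda>. 0 \<le> l x) \<longleftrightarrow> (\<forall>f. 0 \<le> pcoord x f) \<and> (\<forall>f. 0 \<le> mcoord x f)
        \<and> (\<forall>f\<in>-N. pcoord x f \<le> 0) \<and> (\<forall>f\<in>-N. mcoord x f \<le> 0)
        \<and> (\<forall>h. h \<noteq> bot \<longrightarrow> light_coord g x \<le> light_coord h x)"
      by (simp add: ball_Un)
    also have "\<dots> \<longleftrightarrow> x \<in> light_cell N g"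
      unfolding light_cell_def orthant2_eq mem_Collect_eq Ball_def Compl_iff
      by (auto intro: order_antisym)
    finally show "x \<in> light_cell N g \<longleftrightarrow> x \<in> {x. \<forall>l\<in>?\<Lambda>. 0 \<le> l x}" by simp
  qed
  ultimately show ?thesis by (intro exI[of _ ?\<Lambda>] conjI)
qed

lemma polyhedron_light_cell: "polyhedron (light_cell N g)"
proof -
  obtain \<Lambda> where "finite \<Lambda>" "\<forall>l\<in>\<Lambda>. linear l"
    and eq: "light_cell N g = {x. \<forall>l\<in>\<Lambda>. 0 \<le> (l x :: real)}"
    using light_cell_inequalities[of N g] by auto
  then show ?thesis unfolding eq by (intro polyhedron_linear_inequalities) auto
qed

lemma convex_cone_light_cell: "convex_cone (light_cell N g)"
proof -
  obtain \<Lambda> where "\<forall>l\<in>\<Lambda>. linear l"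
    and eq: "light_cell N g = {x. \<forall>l\<in>\<Lambda>. 0 \<le> (l x :: real)}"
    using light_cell_inequalities[of N g] by auto
  then show ?thesis unfolding eq by (intro convex_cone_linear_inequalities) auto
qed

lemma convex_light_cell: "convex (light_cell N g)"
  using convex_cone_light_cell unfolding convex_cone_def by auto

lemma light_cell_pointed:
  assumes "x \<in> light_cell N g" "- x \<in> light_cell N g"
  shows "x = 0"
proof -
  have "0 \<le> pcoord y f \<and> 0 \<le> mcoord y f" if "y \<in> light_cell N g" for y f
    using that unfolding light_cell_def orthant2_eq by auto
  from this[OF assms(1)] this[OF assms(2)] have "pcoord x f = 0 \<and> mcoord x f = 0" for f
    by (smt (verit) fst_uminus snd_uminus vector_uminus_component)
  then show ?thesis by (simp add: prod_eq_iff vec_eq_iff)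
qed

text \<open>On the cell of \<open>g\<close> the form \<open>\<Phi>\<^sub>h - \<Phi>\<^sub>g\<close> is nonnegative, so its zeros are a face, and where it
  vanishes \<open>\<Phi>\<^sub>h\<close> is minimal as well. The other condition for membership in the cell of \<open>h\<close>, to lie
  in the orthant of \<open>M\<close>, defines a face of the orthant of \<open>N\<close>.\<close>

lemma light_cell_Int_face:
  assumes g: "g \<noteq> bot" and h: "h \<noteq> bot"
  shows "light_cell N g \<inter> light_cell M h face_of light_cell N g"
proof -
  let ?l = "\<lambda>x. light_coord h x - light_coord g x"
  have "{x \<in> light_cell N g. ?l x = 0} face_of light_cell N g"
    by (rule face_of_linear_zero[OF convex_light_cell])
       (auto intro: linear_compose_sub linear_light_coord simp: light_cell_def h)
  moreover have "orthant2 (N \<inter> M) \<inter> light_cell N g face_of orthant2 N \<inter> light_cell N g"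
    by (intro face_of_slice orthant2_face convex_light_cell) auto
  then have "orthant2 (N \<inter> M) \<inter> light_cell N g face_of light_cell N g"
    by (simp add: Int_absorb1 light_cell_subset)
  ultimately have "{x \<in> light_cell N g. ?l x = 0} \<inter> (orthant2 (N \<inter> M) \<inter> light_cell N g)
      face_of light_cell N g"
    by (rule face_of_Int)
  also have "{x \<in> light_cell N g. ?l x = 0} \<inter> (orthant2 (N \<inter> M) \<inter> light_cell N g)
      = light_cell N g \<inter> light_cell M h"
    using g h by (auto simp: light_cell_def orthant2_eq intro: antisym)
  finally show ?thesis .
qed

section \<open>Domains of linearity of a minimum of coordinates\<close>

definition min_cone :: "'a::finite set \<Rightarrow> 'a \<Rightarrow> (real, 'a) vec set" where
  "min_cone N g = {y \<in> space1 N. \<forall>h\<in>N. y $ g \<le> y $ h}"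

lemma convex_min_cone: "convex (min_cone N g)"
  unfolding min_cone_def space1_eq convex_def
  by (auto intro!: add_mono mult_left_mono)

text \<open>The singletons contribute linear terms, which do not affect the domains of linearity. If \<open>N\<close> is
  itself a singleton, its only building element gives the minimum and \<open>l\<close> is zero.\<close>

lemma minimal_building_function:
  fixes N :: "'a::finite set"
  assumes "N \<noteq> {}"
  shows "\<exists>l. linear l \<and>
    (\<forall>y. building_function (minimal_building_set N) y = Min ((\<lambda>g. y $ g) ` N) + l y)"
proof (cases "\<exists>f. N = {f}")
  case True
  then have "minimal_building_set N = {N}" unfolding minimal_building_set_def by auto
  then show ?thesis
    unfolding building_function_def by (intro exI[of _ "\<lambda>_. 0"]) (simp add: linear_zero)
next
  case False
  then have eq: "minimal_building_set N = insert N ((\<lambda>f. {f}) ` N)" and "N \<notin> (\<lambda>f. {f}) ` N"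
    using assms unfolding minimal_building_set_def by auto
  moreover have "inj_on (\<lambda>f. {f}) N" by simp
  ultimately have "building_function (minimal_building_set N) y
      = Min ((\<lambda>g. y $ g) ` N) + (\<Sum>f\<in>N. y $ f)" for y
    unfolding building_function_def by (simp add: sum.reindex)
  moreover have "linear (\<lambda>y :: (real, 'a) vec. \<Sum>f\<in>N. y $ f)"
    by (intro linear_compose_sum ballI) (auto intro: linearI)
  ultimately show ?thesis by blast
qed

text \<open>If for each \<open>g\<close> some point \<open>p\<^sub>g\<close> of \<open>D\<close> had a coordinate smaller than the one at \<open>g\<close>, then at the
  barycentre of the \<open>p\<^sub>g\<close> every coordinate would exceed the average of the minima at the \<open>p\<^sub>g\<close>, which
  by linearity is the minimum at the barycentre.\<close>

lemma linear_min_attained_uniformly: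
  fixes D :: "(real, 'a::finite) vec set"
  assumes D: "convex D" and ne: "N \<noteq> {}" and l: "linear l"
    and eq: "\<And>y. y \<in> D \<Longrightarrow> Min ((\<lambda>g. y $ g) ` N) = l y"
  shows "\<exists>g\<in>N. \<forall>y\<in>D. \<forall>h\<in>N. y $ g \<le> y $ h"
proof (rule ccontr)
  assume "\<not> ?thesis"
  then have "\<forall>g\<in>N. \<exists>y\<in>D. \<exists>h\<in>N. y $ h < y $ g" by (auto simp: not_le)
  then obtain p where p: "\<And>g. g \<in> N \<Longrightarrow> p g \<in> D" and
    ph: "\<And>g. g \<in> N \<Longrightarrow> \<exists>h\<in>N. p g $ h < p g $ g"
    by metis
  have le: "l y \<le> y $ g" if "y \<in> D" "g \<in> N" for y g
    using eq[OF that(1)] that(2) by (metis Min_le finite finite_imageI imageI)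
  have less: "l (p g) < p g $ g" if "g \<in> N" for g
    using ph[OF that] le[OF p[OF that]] by force
  define w where "w = 1 / real (card N)"
  have w: "w > 0" "(\<Sum>g\<in>N. w) = 1" using ne by (auto simp: w_def card_gt_0_iff)
  define c where "c = (\<Sum>g\<in>N. w *\<^sub>R p g)"
  have c: "c \<in> D"
    unfolding c_def by (rule convex_sum[OF _ D]) (use w p in auto)
  have "Min ((\<lambda>g. c $ g) ` N) \<in> (\<lambda>g. c $ g) ` N" using ne by (intro Min_in) auto
  then obtain g where g: "g \<in> N" "l c = c $ g" using eq[OF c] by auto
  have "l c = (\<Sum>h\<in>N. w * l (p h))"
    unfolding c_def by (simp add: linear_sum[OF l] linear_cmul[OF l])
  also have "\<dots> < (\<Sum>h\<in>N. w * (p h $ g))"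
    using w le p less g(1) by (intro sum_strict_mono_ex1) (auto intro!: bexI[of _ g])
  also have "\<dots> = c $ g" unfolding c_def by simp
  finally show False using g(2) by simp
qed

lemma linearity_domains_minimal:
  fixes N :: "'a::finite set"
  assumes ne: "N \<noteq> {}"
  shows "linearity_domains (space1 N) (building_function (minimal_building_set N))
    = min_cone N ` N" (is "linearity_domains ?V ?b = _")
proof -
  obtain l where l: "linear l" and b: "\<And>y. ?b y = Min ((\<lambda>g. y $ g) ` N) + l y"
    using minimal_building_function[OF ne] by auto
  have piece: "linear_piece ?V ?b D \<longleftrightarrow> convex D \<and> (\<exists>g\<in>N. D \<subseteq> min_cone N g)" for D
  proof
    assume D: "linear_piece ?V ?b D"
    then obtain k where k: "linear k" "\<And>y. y \<in> D \<Longrightarrow> ?b y = k y"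
      unfolding linear_piece_def by auto
    have "\<exists>g\<in>N. \<forall>y\<in>D. \<forall>h\<in>N. y $ g \<le> y $ h"
    proof (rule linear_min_attained_uniformly[OF _ ne])
      show "convex D" using D unfolding linear_piece_def by simp
      show "linear (\<lambda>y. k y - l y)" using linear_compose_sub[OF k(1) l] .
      show "Min ((\<lambda>g. y $ g) ` N) = k y - l y" if "y \<in> D" for y
        using k(2)[OF that] b[of y] by simp
    qed
    then show "convex D \<and> (\<exists>g\<in>N. D \<subseteq> min_cone N g)"
      using D unfolding linear_piece_def min_cone_def by blast
  next
    assume "convex D \<and> (\<exists>g\<in>N. D \<subseteq> min_cone N g)"
    then obtain g where D: "convex D" and g: "g \<in> N" "D \<subseteq> min_cone N g" by auto
    have "?b y = y $ g + l y" if "y \<in> D" for y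
    proof -
      have "Min ((\<lambda>g. y $ g) ` N) = y $ g"
        using g that unfolding min_cone_def by (intro Min_eqI) auto
      then show ?thesis using b by simp
    qed
    moreover have "linear (\<lambda>y. y $ g + l y)"
      by (intro linear_compose_add l) (auto intro: linearI)
    moreover have "D \<subseteq> ?V" using g(2) unfolding min_cone_def by auto
    ultimately show "linear_piece ?V ?b D" unfolding linear_piece_def using D by blast
  qed
  have distinct: "g = h" if "g \<in> N" "h \<in> N" "min_cone N g \<subseteq> min_cone N h" for g h
  proof (rule ccontr)
    assume "g \<noteq> h"
    \<comment> \<open>at \<open>- axis g 1\<close> the coordinate \<open>g\<close> is the only minimal one\<close>
    have "- axis g 1 \<in> min_cone N g"
      using that(1) unfolding min_cone_def space1_eq by (auto simp: axis_nth_eq)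
    then have "- axis g 1 \<in> min_cone N h" using that(3) by auto
    then have "(- axis g 1 :: (real, 'a) vec) $ h \<le> (- axis g 1 :: (real, 'a) vec) $ g"
      using that(1) unfolding min_cone_def by blast
    then show False using \<open>g \<noteq> h\<close> by (simp add: axis_nth_eq)
  qed
  show ?thesis
  proof (intro equalityI subsetI)
    fix D assume "D \<in> linearity_domains ?V ?b"
    then have D: "convex D \<and> (\<exists>g\<in>N. D \<subseteq> min_cone N g)"
      and max: "\<And>E. linear_piece ?V ?b E \<Longrightarrow> D \<subseteq> E \<Longrightarrow> E = D"
      unfolding linearity_domains_def piece[symmetric] by auto
    then obtain g where g: "g \<in> N" "D \<subseteq> min_cone N g" by auto
    have "min_cone N g = D"
      using max[OF _ g(2)] g(1) convex_min_cone unfolding piece by blast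
    then show "D \<in> min_cone N ` N" using g(1) by auto
  next
    fix D assume "D \<in> min_cone N ` N"
    then obtain g where g: "g \<in> N" "D = min_cone N g" by auto
    have "linear_piece ?V ?b D" unfolding piece using g convex_min_cone by auto
    moreover have "E = D" if E: "linear_piece ?V ?b E" "D \<subseteq> E" for E
    proof -
      obtain h where h: "h \<in> N" "E \<subseteq> min_cone N h" using E(1) unfolding piece by auto
      then have "g = h" using distinct[OF g(1) h(1)] E(2) g(2) by auto
      then show ?thesis using h E(2) g(2) by auto
    qed
    ultimately show "D \<in> linearity_domains ?V ?b" unfolding linearity_domains_def by auto
  qed
qed

section \<open>The minimal lightcone subdivision of an orthant\<close>

definition light_vec :: "'a::{finite,bounded_lattice} set \<Rightarrow> 'a signed_vec \<Rightarrow> (real, 'a) vec" where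
  "light_vec N x = (\<Sum>f\<in>N.
     pcoord x f *\<^sub>R (\<Sum>g\<in>{g\<in>N. g < f}. axis g 1) +
     mcoord x f *\<^sub>R (\<Sum>g\<in>{g\<in>N. g > f \<or> inf g f = bot}. axis g 1))"

lemma light_map_eq: "light_map N x = quot N (light_vec N x)"
  unfolding light_map_def light_vec_def ..

lemma linear_light_vec: "linear (light_vec N)"
  unfolding light_vec_def
  by (rule linearI) (simp_all add: scaleR_left_distrib sum.distrib scaleR_sum_right
      scaleR_right_distrib)

lemma sum_axis_nth: "(\<Sum>g\<in>S. axis g (1::real)) $ h = (if h \<in> S then 1 else 0)"
  for S :: "'a::finite set"
  by (simp add: axis_nth_eq)

lemma light_vec_in_space1: "light_vec N x \<in> space1 N"
  unfolding light_vec_def space1_eq by (simp add: axis_nth_eq)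

lemma light_vec_nth:
  assumes G: "nestable G" and N: "nested G N" and g: "g \<in> N" and x: "x \<in> orthant2 N"
  shows "light_vec N x $ g = light_coord g x"
proof -
  have "g > f \<or> inf g f = bot \<longleftrightarrow> \<not> g \<le> f" if f: "f \<in> N" for f
  proof -
    have "g \<noteq> bot" using G N g unfolding nestable_def nested_def by auto
    then have "\<not> g \<le> f" if "inf g f = bot" using that by (auto simp: inf_absorb1)
    then show ?thesis using nested_forest[OF G N g f] by (auto simp: order_less_le)
  qed
  then have "light_vec N x $ g
      = (\<Sum>f\<in>N. (if g < f then pcoord x f else 0) + (if \<not> g \<le> f then mcoord x f else 0))"
    unfolding light_vec_def sum_component using g
    by (intro sum.cong) (auto simp: sum_axis_nth simp del: sum_component)
  also have "\<dots> = light_coord g x"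
    unfolding light_coord_nested[OF x] by (simp add: sum.distrib sum.inter_filter)
  finally show ?thesis .
qed

lemma light_vec_in_min_cone:
  assumes "nestable G" "nested G N" "g \<in> N"
  shows "{x \<in> orthant2 N. light_vec N x \<in> min_cone N g} = light_cell N g"
  unfolding light_cell_eq[OF assms] min_cone_def
  using light_vec_in_space1 light_vec_nth[OF assms(1,2)] assms(3) by auto

text \<open>Passing to cosets loses nothing, since a cone \<open>min_cone N g\<close> contains with each point the line in
  direction \<open>u_tot N\<close>, and then so do its faces.\<close>

lemma quot_in_image_face:
  assumes F: "F face_of min_cone N g" and g: "g \<in> N"
  shows "quot N y \<in> quot N ` F \<longleftrightarrow> y \<in> F"
proof
  assume "quot N y \<in> quot N ` F"
  then obtain z where z: "z \<in> F" "quot N y = quot N z" by auto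
  have "y \<in> quot N y" unfolding quot_def by (auto intro!: image_eqI[of _ _ 0] span_zero)
  then obtain s where "s \<in> span {u_tot N}" "y = z + s"
    unfolding z(2) by (auto simp: quot_def)
  then obtain c where y: "y = z + c *\<^sub>R u_tot N" by (auto simp: span_singleton)
  show "y \<in> F"
  proof (cases "c = 0")
    case True
    then show ?thesis using y z by simp
  next
    case False
    have u: "u_tot N $ h = (if h \<in> N then 1 else 0)" for h
      unfolding u_tot_def by (rule sum_axis_nth)
    have line: "z + t *\<^sub>R u_tot N \<in> min_cone N g" for t
      using z(1) face_of_imp_subset[OF F] g unfolding min_cone_def space1_eq by (auto simp: u)
    \<comment> \<open>\<open>z\<close> is the midpoint of \<open>z - c u\<close> and \<open>z + c u\<close>\<close>
    have "z \<in> open_segment (z + (-c) *\<^sub>R u_tot N) (z + c *\<^sub>R u_tot N)"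
    proof -
      have "u_tot N \<noteq> 0" using u[of g] g by auto
      then have "(- c) *\<^sub>R u_tot N \<noteq> c *\<^sub>R u_tot N" using False by (subst scaleR_cancel_right) auto
      then have "z + (-c) *\<^sub>R u_tot N \<noteq> z + c *\<^sub>R u_tot N" by simp
      moreover have "z = (1 - 1/2) *\<^sub>R (z + (-c) *\<^sub>R u_tot N) + (1/2) *\<^sub>R (z + c *\<^sub>R u_tot N)"
        by (simp add: vec_eq_iff field_simps)
      ultimately show ?thesis unfolding in_segment(2) by (intro conjI exI[of _ "1/2"]) auto
    qed
    then show ?thesis using F line z(1) unfolding y face_of_def by blast
  qed
qed auto

text \<open>Lower-dimensional cones of the building fan give nothing new, as the preimage of a face under a
  linear map is a face of the preimage.\<close>

lemma lightcone_subdivision_minimal: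
  assumes G: "nestable G" and N: "nested G N" and ne: "N \<noteq> {}"
  shows "lightcone_subdivision N (minimal_building_set N) = (\<Union>g\<in>N. faces (light_cell N g))"
proof -
  have preimage: "{x \<in> orthant2 N. light_map N x \<in> quot N ` F} = {x \<in> orthant2 N. light_vec N x \<in> F}"
    if "g \<in> N" "F face_of min_cone N g" for g F
    unfolding light_map_eq quot_in_image_face[OF that(2,1)] ..
  have "lightcone_subdivision N (minimal_building_set N)
      = (\<Union>g\<in>N. \<Union>F\<in>faces (min_cone N g). faces {x \<in> orthant2 N. light_map N x \<in> quot N ` F})"
    unfolding lightcone_subdivision_def building_fan_def linearity_domains_minimal[OF ne] by auto
  also have "\<dots> = (\<Union>g\<in>N. \<Union>F\<in>faces (min_cone N g). faces {x \<in> orthant2 N. light_vec N x \<in> F})"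
    using preimage unfolding faces_def by (intro SUP_cong refl) auto
  also have "\<dots> = (\<Union>g\<in>N. faces (light_cell N g))"
  proof (intro SUP_cong refl equalityI)
    fix g assume g: "g \<in> N"
    note cell = light_vec_in_min_cone[OF G N g]
    have "{x \<in> orthant2 N. light_vec N x \<in> F} face_of light_cell N g"
      if "F \<in> faces (min_cone N g)" for F
      unfolding cell[symmetric] using that unfolding faces_def
      by (intro face_of_linear_vimage[OF linear_light_vec convex_orthant2]) auto
    then show "(\<Union>F\<in>faces (min_cone N g). faces {x \<in> orthant2 N. light_vec N x \<in> F})
        \<subseteq> faces (light_cell N g)"
      using faces_trans by blast
    have "0 \<in> min_cone N g" unfolding min_cone_def space1_eq by simp
    then have "min_cone N g \<in> faces (min_cone N g)"
      unfolding faces_def using face_of_refl[OF convex_min_cone] by auto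
    then show "faces (light_cell N g)
        \<subseteq> (\<Union>F\<in>faces (min_cone N g). faces {x \<in> orthant2 N. light_vec N x \<in> F})"
      unfolding cell[symmetric] by (rule UN_upper)
  qed
  finally show ?thesis .
qed

lemma light_cell_empty: "light_cell {} g = {0}"
proof -
  have "orthant2 {} = {0 :: 'a signed_vec}" unfolding orthant2_def by simp
  then show ?thesis
    unfolding light_cell_def
    by (simp add: set_eq_iff linear_0[OF linear_light_coord] cong: conj_cong)
qed

lemma lightcone_subdivision_empty:
  "lightcone_subdivision {} (minimal_building_set {})
    = faces {0 :: 'a::{finite,bounded_lattice} signed_vec}"
proof -
  let ?z = "{0 :: (real, 'a) vec}"
  have fz: "faces ?z = {?z}"
    unfolding faces_def using face_of_imp_subset face_of_refl[of ?z] by fastforce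
  have V: "space1 {} = ?z" unfolding space1_def by simp
  have "minimal_building_set {} = ({} :: 'a set set)" unfolding minimal_building_set_def by auto
  then have b: "building_function (minimal_building_set ({} :: 'a set)) = (\<lambda>_. 0)"
    unfolding building_function_def by auto
  have piece: "linear_piece ?z (\<lambda>_. 0) D \<longleftrightarrow> D \<subseteq> ?z" for D
    unfolding linear_piece_def using linear_zero subset_singletonD[of D 0] by fastforce
  have "linearity_domains ?z (\<lambda>_. 0) = {?z}"
    unfolding linearity_domains_def piece by blast
  then have fan: "building_fan {} (minimal_building_set ({} :: 'a set)) = {quot {} ` ?z}"
    unfolding building_fan_def V b by (simp add: fz)
  have "light_vec {} x = 0" for x :: "'a signed_vec" unfolding light_vec_def by simp
  then show ?thesis
    unfolding lightcone_subdivision_def fan light_map_eq orthant2_def by simp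
qed

section \<open>The refinement is a fan\<close>

text \<open>The empty nested set has only the cell \<open>{0}\<close>, for which any \<open>g \<noteq> bot\<close> may serve as index.\<close>

definition light_cells :: "'a::{finite,bounded_lattice} set \<Rightarrow> 'a signed_vec set set" where
  "light_cells G = {light_cell N g | N g. nested G N \<and> g \<noteq> bot \<and> (N = {} \<or> g \<in> N)}"

lemma minimal_lightcone_refinement_eq:
  assumes G: "nestable G"
  shows "minimal_lightcone_refinement G = (\<Union>C\<in>light_cells G. faces C)"
proof -
  have bot: "bot \<notin> N" if "nested G N" for N using that G unfolding nestable_def nested_def by auto
  have top: "top \<noteq> (bot :: 'a)" using G unfolding nestable_def by auto
  have sub: "lightcone_subdivision N (minimal_building_set N)
      = (\<Union>g\<in>{g. g \<noteq> bot \<and> (N = {} \<or> g \<in> N)}. faces (light_cell N g))" if N: "nested G N" for N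
  proof (cases "N = {}")
    case True
    then show ?thesis using top by (auto simp: lightcone_subdivision_empty light_cell_empty)
  next
    case False
    moreover have "{g. g \<noteq> bot \<and> (N = {} \<or> g \<in> N)} = N" using False bot[OF N] by auto
    ultimately show ?thesis using lightcone_subdivision_minimal[OF G N] by simp
  qed
  show ?thesis
    unfolding minimal_lightcone_refinement_def nested_complex_def light_cells_def
    using sub by auto
qed

lemma fan_minimal_lightcone_refinement:
  assumes "nestable G"
  shows "fan (minimal_lightcone_refinement G)"
  unfolding minimal_lightcone_refinement_eq[OF assms]
proof (rule fan_generated_by_cells)
  have "light_cells G \<subseteq> range (\<lambda>(N, g). light_cell N g)" unfolding light_cells_def by auto
  then show "finite (light_cells G)" by (rule finite_subset) simp
next
  fix C assume "C \<in> light_cells G"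
  then obtain N g where C: "C = light_cell N g" and g: "g \<noteq> bot"
    unfolding light_cells_def by blast
  show "convex_cone C" "polyhedron C"
    unfolding C by (rule convex_cone_light_cell polyhedron_light_cell)+
  show "x = 0" if "x \<in> C" "- x \<in> C" for x
    using that unfolding C by (rule light_cell_pointed)
  fix D assume "D \<in> light_cells G"
  then obtain M h where D: "D = light_cell M h" and h: "h \<noteq> bot"
    unfolding light_cells_def by blast
  show "C \<inter> D face_of C" unfolding C D using g h by (rule light_cell_Int_face)
qed

section \<open>The causal cone\<close>

text \<open>As \<open>m\<close> vanishes at \<open>top\<close>, the form \<open>\<Phi>\<^sub>t\<close> for \<open>t = top\<close> is the sum of all \<open>m\<^sub>f\<close>; splitting it into
  the summands with \<open>g \<le> f\<close> and the rest gives the identity. For \<open>g = top\<close> the left-hand side is \<open>p\<close> at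
  \<open>top\<close> and the right-hand side is zero.\<close>

lemma causal_form_eq:
  assumes x: "x \<in> orthant2 G" and m: "mcoord x top = 0" and g: "g \<noteq> top"
  shows "causal_form G g x = light_coord g x - light_coord top x"
proof -
  let ?I = "{f. g < f \<and> f < top}"
  have above: "{f. g < f} = insert top ?I"
    using g by (auto simp: less_top)
  have "{f. g \<le> f} = insert g {f. g < f}" by (auto simp: order_less_le)
  then have "sum (mcoord x) {f. g \<le> f} = mcoord x g + sum (mcoord x) ?I"
    using above m g by simp
  moreover have "sum (mcoord x) UNIV = sum (mcoord x) {f. g \<le> f} + sum (mcoord x) {f. \<not> g \<le> f}"
    using sum.union_disjoint[of "{f. g \<le> f}" "{f. \<not> g \<le> f}" "mcoord x"]
    by (auto simp: Collect_disj_eq[symmetric] Un_def)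
  moreover have "sum (mcoord x) UNIV = sum (mcoord x) {f. \<not> top \<le> f}"
    by (rule sum.mono_neutral_right) (auto simp: m top_unique)
  moreover have "sum (pcoord x) {f. g < f} = pcoord x top + sum (pcoord x) ?I"
    using above by simp
  moreover have "(\<Sum>f\<in>{f \<in> G. g < f \<and> f < top}. pcoord x f - mcoord x f)
      = sum (pcoord x) ?I - sum (mcoord x) ?I"
    unfolding sum_subtractf[symmetric] using x
    by (intro sum_support[symmetric]) (auto simp: orthant2_eq)
  moreover have none: "{f :: 'a. top < f} = {}" by simp
  ultimately show ?thesis unfolding causal_form_def light_coord_def none by simp
qed

text \<open>The causal inequalities range over \<open>G\<close> and the inequalities of the cell of \<open>top\<close> over the
  elements other than \<open>bot\<close>; both families follow from their members in \<open>N\<close>.\<close>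

lemma causal_cone_on_orthant:
  assumes G: "nestable G" and N: "nested G N" and top: "top \<in> N"
  shows "orthant2 N \<inter> causal_cone G = {x \<in> light_cell N top. mcoord x top = 0}"
proof -
  have NG: "N \<subseteq> G" using N unfolding nested_def by simp
  have bot: "bot \<notin> G" using G unfolding nestable_def by auto
  have "x \<in> causal_cone G \<longleftrightarrow> x \<in> light_cell N top \<and> mcoord x top = 0" if x: "x \<in> orthant2 N" for x
  proof -
    have xG: "x \<in> orthant2 G" using x NG unfolding orthant2_eq by auto
    have "orthant2 G \<subseteq> space2 G"
      unfolding orthant2_def space2_def
      by (rule hull_minimal) (auto simp: convex_cone_span intro: span_base)
    then have "x \<in> causal_cone G \<longleftrightarrow> mcoord x top = 0 \<and> (\<forall>g\<in>G. 0 \<le> causal_form G g x)"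
      using xG unfolding causal_cone_def by (auto simp: orthant2_eq)
    also have "\<dots> \<longleftrightarrow> mcoord x top = 0 \<and> (\<forall>g\<in>G. light_coord top x \<le> light_coord g x)"
    proof (intro conj_cong ball_cong refl)
      fix g assume m: "mcoord x top = 0"
      show "0 \<le> causal_form G g x \<longleftrightarrow> light_coord top x \<le> light_coord g x"
      proof (cases "g = top")
        case True
        have none: "{f \<in> G. top < f \<and> f < top} = {}" by auto
        have "0 \<le> causal_form G top x"
          unfolding causal_form_def none using x m by (simp add: orthant2_eq)
        then show ?thesis using True by simp
      next
        case False
        then show ?thesis using causal_form_eq[OF xG m] by simp
      qed
    qed
    also have "\<dots> \<longleftrightarrow> mcoord x top = 0 \<and> x \<in> light_cell N top"
    proof (intro conj_cong refl iffI)
      assume "\<forall>g\<in>G. light_coord top x \<le> light_coord g x"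
      then show "x \<in> light_cell N top" using NG x unfolding light_cell_eq[OF G N top] by auto
    next
      assume cell: "x \<in> light_cell N top"
      show "\<forall>g\<in>G. light_coord top x \<le> light_coord g x"
      proof
        fix g assume "g \<in> G"
        then have "g \<noteq> bot" using bot by auto
        then show "light_coord top x \<le> light_coord g x"
          using cell unfolding light_cell_def by simp
      qed
    qed
    finally show ?thesis by auto
  qed
  then show ?thesis using light_cell_subset by blast
qed

lemma universe_fan_subset_refinement:
  assumes G: "nestable G"
  shows "universe_fan G \<subseteq> minimal_lightcone_refinement G"
proof
  fix F assume "F \<in> universe_fan G"
  then obtain N \<sigma> where N: "nested G N" and \<sigma>: "\<sigma> face_of orthant2 N"
    and F: "F \<in> faces (\<sigma> \<inter> causal_cone G)"
    unfolding universe_fan_def Sigma2_def nested_complex_def faces_def by auto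
  let ?T = "insert top N"
  have T: "nested G ?T" using nested_insert_top[OF G N] .
  have "(orthant2 ?T \<inter> causal_cone G) face_of light_cell ?T top"
    unfolding causal_cone_on_orthant[OF G T insertI1]
    by (rule face_of_linear_zero[OF convex_light_cell linear_mcoord])
       (use light_cell_subset in \<open>force simp: orthant2_eq\<close>)
  moreover have "\<sigma> \<inter> causal_cone G face_of orthant2 ?T \<inter> causal_cone G"
  proof -
    have \<sigma>T: "\<sigma> face_of orthant2 ?T"
      using face_of_trans[OF \<sigma> orthant2_face] by auto
    have "\<sigma> \<inter> (orthant2 ?T \<inter> causal_cone G) face_of orthant2 ?T \<inter> (orthant2 ?T \<inter> causal_cone G)"
      by (rule face_of_slice[OF \<sigma>T]) (use calculation face_of_imp_convex in blast)
    then show ?thesis using face_of_imp_subset[OF \<sigma>T] by (simp add: Int_assoc[symmetric] Int_absorb2)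
  qed
  ultimately have "\<sigma> \<inter> causal_cone G face_of light_cell ?T top" using face_of_trans by blast
  then have "F \<in> faces (light_cell ?T top)" using F faces_trans by blast
  moreover have "top \<noteq> (bot :: 'a)" using G unfolding nestable_def by auto
  then have "light_cell ?T top \<in> light_cells G" using T unfolding light_cells_def by blast
  ultimately show "F \<in> minimal_lightcone_refinement G"
    unfolding minimal_lightcone_refinement_eq[OF G] by blast
qed

theorem theorem5p11:
  fixes G :: "'a::{finite,bounded_lattice} set"
  assumes "nestoid G"
  shows "subfan (universe_fan G) (minimal_lightcone_refinement G)"
proof -
  have G: "nestable G" using assms unfolding nestoid_def by simp
  show ?thesis
  proof (rule subfan_closed_under_faces)
    show "fan (minimal_lightcone_refinement G)" using fan_minimal_lightcone_refinement[OF G] .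
    show "universe_fan G \<subseteq> minimal_lightcone_refinement G"
      using universe_fan_subset_refinement[OF G] .
    show "faces C \<subseteq> universe_fan G" if "C \<in> universe_fan G" for C
      using that faces_trans unfolding universe_fan_def faces_def by blast
  qed
qed

end
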